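(* Let $q \geq 2$ be an integer, and let $(C_n)_{n\ge 1}$ be a family of codes such that, for each $n$, $C_n \subseteq \{0,1,\ldots,q-1\}^n$ is a $q$-ary $B_2$ code of length $n$. Then $$\limsup_{n \to \infty} \frac{1}{n} \log_q |C_n| \leq \frac{q+(q-1)\log_q 2}{2q+(q-1)\log_q 2}.$$
   Context: A $q$-ary code of length $n$ is a subset $C_n \subseteq \{0,1,\ldots,q-1\}^n$; its elements are called codewords. Write $C_n = \{c_1, \ldots, c_M\}$ with $M = |C_n|$ and the $c_i$ distinct. The code $C_n$ is a $q$-ary $B_2$ code if all the sums $c_i + c_j$ with $1 \leq i \leq j \leq M$ (componentwise addition of real vectors, not modulo $q$) are different, i.e. distinct index pairs $(i,j)$ with $i \le j$ give distinct sums. By convention $\log_q 0 = -\infty$. *)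

theory Defs
  imports "HOL-Analysis.Analysis"
begin

(* A word of length n over {0,...,q-1} is a list of naturals. *)
definition qary_code :: "nat \<Rightarrow> nat \<Rightarrow> nat list set \<Rightarrow> bool" where
  "qary_code q n C \<longleftrightarrow> C \<subseteq> {c. length c = n \<and> set c \<subseteq> {0..<q}}"

(* Addition in nat, with no reduction modulo q: the entries are nonnegative integers, so two sums
   agree here exactly when they agree as real vectors. *)
definition word_add :: "nat list \<Rightarrow> nat list \<Rightarrow> nat list" where
  "word_add a b = map2 (+) a b"

(* The choice of the enumeration c is immaterial, see B2_code_iff. *)
definition B2_code :: "nat \<Rightarrow> nat \<Rightarrow> nat list set \<Rightarrow> bool" where
  "B2_code q n C \<longleftrightarrow> qary_code q n C \<and>
     (\<exists>c. bij_betw c {1..card C} C \<and>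
        inj_on (\<lambda>(i, j). word_add (c i) (c j)) {(i, j). 1 \<le> i \<and> i \<le> j \<and> j \<le> card C})"

(* Base-q logarithm of a natural number, with the convention log_q 0 = -infinity
   (the library has log q 0 = 0). *)
definition elog :: "nat \<Rightarrow> nat \<Rightarrow> ereal" where
  "elog q m = (if m = 0 then -\<infinity> else ereal (log (real q) (real m)))"

lemma qary_code_finite: "qary_code q n C \<Longrightarrow> finite C"
  unfolding qary_code_def
  by (rule finite_subset[OF _ finite_lists_length_eq[of "{0..<q}" n]]) auto

lemma word_add_commute: "word_add a b = word_add b a"
  unfolding word_add_def
  by (rule nth_equalityI) (auto simp: add.commute)

lemma inj_on_sums_iff:
  assumes c: "bij_betw c {1..M} C"
  shows "inj_on (\<lambda>(i, j). word_add (c i) (c j)) {(i, j). 1 \<le> i \<and> i \<le> j \<and> j \<le> (M::nat)} \<longleftrightarrow>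
    (\<forall>x\<in>C. \<forall>y\<in>C. \<forall>u\<in>C. \<forall>v\<in>C. word_add x y = word_add u v \<longrightarrow> {x, y} = {u, v})"
  (is "?L \<longleftrightarrow> ?R")
proof
  assume L: ?L
  have ordered: "\<exists>i j. 1 \<le> i \<and> i \<le> j \<and> j \<le> M \<and> {x, y} = {c i, c j} \<and>
      word_add x y = word_add (c i) (c j)" if "x \<in> C" "y \<in> C" for x y
  proof -
    have "x \<in> c ` {1..M}" "y \<in> c ` {1..M}"
      using that bij_betw_imp_surj_on[OF c] by simp_all
    then obtain i j where ij: "i \<in> {1..M}" "j \<in> {1..M}" "x = c i" "y = c j"
      by (elim imageE)
    show ?thesis
    proof (cases "i \<le> j")
      case True
      with ij show ?thesis by (intro exI[of _ i] exI[of _ j]) auto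
    next
      case False
      with ij show ?thesis
        by (intro exI[of _ j] exI[of _ i]) (auto simp: word_add_commute[of "c i" "c j"])
    qed
  qed
  show ?R
  proof (intro ballI impI)
    fix x y u v assume xy: "x \<in> C" "y \<in> C" and uv: "u \<in> C" "v \<in> C"
      and eq: "word_add x y = word_add u v"
    obtain i j where ij: "1 \<le> i" "i \<le> j" "j \<le> M" "{x, y} = {c i, c j}"
      "word_add x y = word_add (c i) (c j)" using ordered[OF xy] by blast
    obtain k l where kl: "1 \<le> k" "k \<le> l" "l \<le> M" "{u, v} = {c k, c l}"
      "word_add u v = word_add (c k) (c l)" using ordered[OF uv] by blast
    have "(i, j) = (k, l)" by (rule inj_onD[OF L]) (use ij kl eq in auto)
    with ij kl show "{x, y} = {u, v}" by simp
  qed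
next
  assume R: ?R
  show ?L
  proof (rule inj_onI, clarify)
    fix i j k l assume ij: "1 \<le> i" "i \<le> j" "j \<le> M" and kl: "1 \<le> k" "k \<le> l" "l \<le> M"
      and eq: "word_add (c i) (c j) = word_add (c k) (c l)"
    have mem: "c i \<in> C" "c j \<in> C" "c k \<in> C" "c l \<in> C"
      using ij kl bij_betwE[OF c] by auto
    have "{c i, c j} = {c k, c l}" using R mem eq by blast
    then have "c ` {i, j} = c ` {k, l}" by (simp only: image_insert image_empty)
    moreover have sub: "{i, j} \<subseteq> {1..M}" "{k, l} \<subseteq> {1..M}" using ij kl by auto
    ultimately have "{i, j} = {k, l}"
      by (simp only: inj_on_image_eq_iff[OF bij_betw_imp_inj_on[OF c] sub])
    with ij kl show "i = k \<and> j = l" by (auto simp: doubleton_eq_iff)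
  qed
qed

lemma B2_code_iff:
  "B2_code q n C \<longleftrightarrow> qary_code q n C \<and>
    (\<forall>x\<in>C. \<forall>y\<in>C. \<forall>u\<in>C. \<forall>v\<in>C. word_add x y = word_add u v \<longrightarrow> {x, y} = {u, v})"
proof -
  have "(\<exists>c. bij_betw c {1..card C} C \<and>
        inj_on (\<lambda>(i, j). word_add (c i) (c j)) {(i, j). 1 \<le> i \<and> i \<le> j \<and> j \<le> card C}) \<longleftrightarrow>
      (\<exists>c. bij_betw c {1..card C} C) \<and>
      (\<forall>x\<in>C. \<forall>y\<in>C. \<forall>u\<in>C. \<forall>v\<in>C. word_add x y = word_add u v \<longrightarrow> {x, y} = {u, v})"
    by (simp only: inj_on_sums_iff ex_simps cong: conj_cong)
  moreover have "\<exists>c. bij_betw c {1..card C} C" if "qary_code q n C"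
    by (rule ex_bij_betw_nat_finite_1[OF qary_code_finite[OF that]])
  ultimately show ?thesis
    unfolding B2_code_def by (simp only: simp_thms cong: conj_cong)
qed

end

theory Submission
  imports Defs "HOL-Real_Asymp.Real_Asymp"
begin

text \<open>
  Fix a prefix length \<open>m\<close> and look at the pairs of distinct codewords that agree in their first
  \<open>m\<close> places. In a \<open>B\<^sub>2\<close> code such a pair is determined by the difference of its two suffixes,
  because \<open>x - y = u - v\<close> is the same as \<open>x + v = u + y\<close>
  (\<open>B2_code_inj_on_suffix_difference\<close>). The number of such pairs is therefore a number
  of distinct vectors, which an entropy argument bounds. Two independent
  samples of a distribution on \<open>q\<close> symbols coincide with probability at least \<open>1 / q\<close>; hence the
  difference in one place is nonzero with probability at most \<open>1 - 1 / q\<close>. Its absolute value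
  takes \<open>q\<close> values and its sign costs one bit when it is nonzero, which gives at most
  \<open>H = 1 + (1 - 1 / q) log\<^sub>q 2\<close> \<open>q\<close>-ary units of information per place
  (\<open>B2_code_card_pairs_le\<close>).

  Among \<open>M\<^sup>2\<close> pairs of codewords at least \<open>M\<^sup>2 / q\<^sup>m\<close> agree in the first \<open>m\<close> places. Writing
  \<open>R\<close> for the rate and \<open>\<mu> = m / n\<close>, this yields \<open>2 R - \<mu> \<le> (1 - \<mu>) H\<close> as long as the \<open>M\<close>
  diagonal pairs are negligible among them, that is, for \<open>\<mu>\<close> just below \<open>R\<close>. As \<open>H \<ge> 1\<close>, this
  largest \<open>\<mu>\<close> is the best choice; it leaves \<open>R \<le> (1 - R) H\<close>, so \<open>R \<le> H / (1 + H)\<close>,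
  which is the claimed bound. The lemma \<open>B2_code_rate_le\<close> does this with explicit error terms.
\<close>

section \<open>Coincidences, weighted words and convexity\<close>

text \<open>
  Within each class of \<open>g\<close>, Cauchy--Schwarz says that the class sizes of a refinement by at most
  \<open>card A\<close> labels have a sum of squares of at least the \<open>card A\<close>-th part of the squared size.
  It serves both for whole prefixes, with \<open>g\<close> constant, and for a single place given the prefix.
\<close>
lemma coincidences_refine:
  fixes f :: "'a \<Rightarrow> 'b" and g :: "'a \<Rightarrow> 'c"
  assumes fin: "finite S" "finite A" and fA: "f ` S \<subseteq> A"
  shows "card {(x, y) \<in> S \<times> S. g x = g y} \<le>
    card A * card {(x, y) \<in> S \<times> S. g x = g y \<and> f x = f y}"
proof -
  define F where "F u a = {x \<in> S. g x = u \<and> f x = a}" for u a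
  have finF: "finite (F u a)" for u a using fin by (auto simp: F_def)
  have fib: "card {x \<in> S. g x = u} = (\<Sum>a\<in>A. card (F u a))" for u
  proof -
    have "{x \<in> S. g x = u} = (\<Union>a\<in>A. F u a)" using fA by (auto simp: F_def)
    then show ?thesis
      by (simp only:, intro card_UN_disjoint) (use fin finF in \<open>auto simp: F_def\<close>)
  qed
  have "{(x, y) \<in> S \<times> S. g x = g y} = (\<Union>u\<in>g ` S. {x \<in> S. g x = u} \<times> {x \<in> S. g x = u})"
    by auto
  then have "card {(x, y) \<in> S \<times> S. g x = g y}
      = (\<Sum>u\<in>g ` S. card ({x \<in> S. g x = u} \<times> {x \<in> S. g x = u}))"
    by (simp only:, intro card_UN_disjoint) (use fin in auto)
  also have "\<dots> = (\<Sum>u\<in>g ` S. (\<Sum>a\<in>A. card (F u a))\<^sup>2)"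
    by (simp add: card_cartesian_product fib power2_eq_square)
  also have "\<dots> \<le> (\<Sum>u\<in>g ` S. card A * (\<Sum>a\<in>A. (card (F u a))\<^sup>2))"
  proof (rule sum_mono)
    fix u
    have "(\<Sum>a\<in>A. real (card (F u a)))\<^sup>2 \<le> (\<Sum>a\<in>A. (1::real)\<^sup>2) * (\<Sum>a\<in>A. (real (card (F u a)))\<^sup>2)"
      using Cauchy_Schwarz_ineq_sum[of "\<lambda>_. 1" "\<lambda>a. real (card (F u a))" A] by simp
    then have "real ((\<Sum>a\<in>A. card (F u a))\<^sup>2) \<le> real (card A * (\<Sum>a\<in>A. (card (F u a))\<^sup>2))"
      by simp
    then show "(\<Sum>a\<in>A. card (F u a))\<^sup>2 \<le> card A * (\<Sum>a\<in>A. (card (F u a))\<^sup>2)"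
      by (simp only: of_nat_le_iff)
  qed
  also have "\<dots> = card A * (\<Sum>p\<in>g ` S \<times> A. card (F (fst p) (snd p) \<times> F (fst p) (snd p)))"
    by (simp add: sum_distrib_left sum.cartesian_product card_cartesian_product
        power2_eq_square split_beta)
  also have "(\<Sum>p\<in>g ` S \<times> A. card (F (fst p) (snd p) \<times> F (fst p) (snd p)))
      = card (\<Union>p\<in>g ` S \<times> A. F (fst p) (snd p) \<times> F (fst p) (snd p))"
    by (rule card_UN_disjoint[symmetric]) (use fin finF in \<open>auto simp: F_def\<close>)
  also have "(\<Union>p\<in>g ` S \<times> A. F (fst p) (snd p) \<times> F (fst p) (snd p))
      = {(x, y) \<in> S \<times> S. g x = g y \<and> f x = f y}"
    using fA by (auto simp: F_def)
  finally show ?thesis .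
qed

lemma sum_prod_list_eq_power:
  fixes w :: "'a \<Rightarrow> 'b::comm_semiring_1"
  assumes "finite A"
  shows "(\<Sum>xs | set xs \<subseteq> A \<and> length xs = k. prod_list (map w xs)) = (\<Sum>a\<in>A. w a) ^ k"
proof (induction k)
  case 0
  have "{xs. set xs \<subseteq> A \<and> length xs = 0} = {[]}" by auto
  then show ?case by simp
next
  case (Suc k)
  let ?L = "{xs. set xs \<subseteq> A \<and> length xs = k}"
  have "{xs. set xs \<subseteq> A \<and> length xs = Suc k} = (\<lambda>(a, xs). a # xs) ` (A \<times> ?L)"
    by (auto simp: length_Suc_conv)
  moreover have "inj_on (\<lambda>(a, xs). a # xs) (A \<times> ?L)"
    by (auto simp: inj_on_def)
  ultimately have "(\<Sum>xs | set xs \<subseteq> A \<and> length xs = Suc k. prod_list (map w xs))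
      = (\<Sum>(a, xs)\<in>A \<times> ?L. w a * prod_list (map w xs))"
    by (simp only: sum.reindex, simp add: split_beta)
  also have "\<dots> = (\<Sum>a\<in>A. w a) * (\<Sum>xs\<in>?L. prod_list (map w xs))"
    by (simp add: sum_product sum.cartesian_product)
  finally show ?case by (simp add: Suc.IH)
qed

text \<open>
  Giving \<open>0\<close> the weight \<open>1\<close> and every other letter the weight \<open>1 / 2\<close> is, up to the factor \<open>q\<close>,
  the distribution on \<open>{- (q - 1)..q - 1}\<close> with uniform absolute value and a fair sign. This is
  the reference measure of the entropy bound.
\<close>
lemma prod_list_half_weight:
  "prod_list (map (\<lambda>a::'a::zero. if a = 0 then 1 else 1 / 2 :: real) xs)
    = (1 / 2) ^ card {j. j < length xs \<and> xs ! j \<noteq> 0}"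
proof -
  have "prod_list (map (\<lambda>a. if a = 0 then 1 else 1 / 2 :: real) xs)
      = (1 / 2) ^ length (filter (\<lambda>a. a \<noteq> 0) xs)"
    by (induction xs) auto
  then show ?thesis by (simp add: length_filter_conv_card)
qed

lemma sum_half_weight:
  assumes "q \<ge> 1"
  shows "(\<Sum>a\<in>{- (int q - 1)..int q - 1}. if a = 0 then 1 else 1 / 2 :: real) = real q"
proof -
  let ?A = "{- (int q - 1)..int q - 1}"
  have "(\<Sum>a\<in>?A. if a = 0 then 1 else 1 / 2 :: real) = 1 + (\<Sum>a\<in>?A - {0}. 1 / 2)"
    using assms by (subst sum.remove[of _ 0]) auto
  also have "\<dots> = real q" using assms by (simp add: card_Diff_singleton of_nat_diff field_simps)
  finally show ?thesis .
qed

text \<open>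
  Jensen's inequality for \<open>exp\<close>, from the tangent at the mean. It replaces the entropy: once
  the total of \<open>exp t\<close> is bounded, a set on which the mean of \<open>t\<close> is not too negative cannot be large.
\<close>
lemma card_le_exp_mean:
  fixes t :: "'a \<Rightarrow> real"
  assumes "finite P" "P \<noteq> {}"
  shows "real (card P) * exp ((\<Sum>p\<in>P. t p) / card P) \<le> (\<Sum>p\<in>P. exp (t p))"
proof -
  define a where "a = (\<Sum>p\<in>P. t p) / card P"
  have pos: "real (card P) > 0" using assms by (simp add: card_gt_0_iff)
  have "real (card P) * exp a = (\<Sum>p\<in>P. exp a * (1 + (t p - a)))"
    using pos by (simp add: sum_distrib_left[symmetric] sum.distrib sum_subtractf a_def)
  also have "\<dots> \<le> (\<Sum>p\<in>P. exp (t p))"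
  proof (rule sum_mono)
    fix p
    have "exp a * (1 + (t p - a)) \<le> exp a * exp (t p - a)"
      by (intro mult_left_mono exp_ge_add_one_self) simp
    then show "exp a * (1 + (t p - a)) \<le> exp (t p)" by (simp flip: exp_add)
  qed
  finally show ?thesis by (simp add: a_def)
qed

section \<open>Pairs of codewords with a common prefix\<close>

lemma B2_code_inj_on_suffix_difference:
  assumes B2: "B2_code q n C"
  shows "inj_on (\<lambda>(x, y). map2 (\<lambda>a b. int a - int b) (drop m x) (drop m y))
    {(x, y) \<in> C \<times> C. take m x = take m y \<and> x \<noteq> y}"
proof (rule inj_onI, clarify)
  fix x y u v
  assume mem: "x \<in> C" "y \<in> C" "u \<in> C" "v \<in> C"
    and pre: "take m x = take m y" "take m u = take m v" and ne: "x \<noteq> y"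
    and eq: "map2 (\<lambda>a b. int a - int b) (drop m x) (drop m y)
      = map2 (\<lambda>a b. int a - int b) (drop m u) (drop m v)"
  have len: "length x = n" "length y = n" "length u = n" "length v = n"
    using mem B2 by (auto simp: B2_code_iff qary_code_def)
  have "word_add x v = word_add u y"
  proof (rule nth_equalityI)
    show "length (word_add x v) = length (word_add u y)" by (simp add: word_add_def len)
    fix i assume "i < length (word_add x v)"
    then have i: "i < n" by (simp add: word_add_def len)
    have "x ! i + v ! i = u ! i + y ! i"
    proof (cases "i < m")
      case True
      have "x ! i = y ! i" "u ! i = v ! i"
        using arg_cong[OF pre(1), of "\<lambda>l. l ! i"] arg_cong[OF pre(2), of "\<lambda>l. l ! i"] True
        by simp_all
      then show ?thesis by simp
    next
      case False
      then have "int (x ! i) - int (y ! i) = int (u ! i) - int (v ! i)"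
        using arg_cong[OF eq, of "\<lambda>l. l ! (i - m)"] i by (simp add: len)
      then show ?thesis by linarith
    qed
    then show "word_add x v ! i = word_add u y ! i"
      using i by (simp add: word_add_def len)
  qed
  then have "{x, v} = {u, y}" using B2 mem unfolding B2_code_iff by blast
  with ne show "x = u \<and> y = v" by (auto simp: doubleton_eq_iff)
qed

text \<open>
  The entropy bound. The factor \<open>(card P + card C) / card P\<close> is the price of discarding the
  diagonal: coincidences are counted over all pairs with a common prefix, while only the pairs in
  \<open>P\<close> are determined by their differences.
\<close>
lemma B2_code_card_pairs_le:
  assumes B2: "B2_code q n C" and q: "q \<ge> 1" and m: "m \<le> n"
    and P_def: "P = {(x, y) \<in> C \<times> C. take m x = take m y \<and> x \<noteq> y}" and ne: "P \<noteq> {}"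
  shows "ln (real (card P)) \<le> real (n - m) *
    (ln q + (1 - 1 / real q) * ln 2 * ((real (card P) + real (card C)) / real (card P)))"
proof -
  define k where "k = n - m"
  define T where "T = {(x, y) \<in> C \<times> C. take m x = take m y}"
  define wt where "wt p = card {j. j < k \<and> fst p ! (m + j) \<noteq> snd p ! (m + j)}"
    for p :: "nat list \<times> nat list"
  define d where "d = (\<lambda>(x, y). map2 (\<lambda>a b. int a - int b) (drop m x) (drop m y))"
  define L where "L = {xs. set xs \<subseteq> {- (int q - 1)..int q - 1} \<and> length xs = k}"
  define w where "w = (\<lambda>a::int. if a = 0 then 1 else 1 / 2 :: real)"
  have qc: "qary_code q n C" using B2 by (simp add: B2_code_def)
  have finC: "finite C" by (rule qary_code_finite[OF qc])
  have len: "length x = n" and ent: "i < n \<Longrightarrow> x ! i < q" if "x \<in> C" for x i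
    using qc that nth_mem[of i x] by (fastforce simp: qary_code_def)+
  have finT: "finite T" using finC by (auto simp: T_def intro: finite_subset[of _ "C \<times> C"])
  have PT: "P \<subseteq> T" by (auto simp: P_def T_def)
  have finP: "finite P" using finT PT by (rule rev_finite_subset)
  have cP: "real (card P) > 0" using finP ne by (simp add: card_gt_0_iff)
  have cT: "card T = card P + card C"
  proof -
    have "T = P \<union> (\<lambda>x. (x, x)) ` C" by (auto simp: T_def P_def)
    then have "card T = card P + card ((\<lambda>x. (x, x)) ` C)"
      by (simp only:, intro card_Un_disjoint) (use finP finC in \<open>auto simp: P_def\<close>)
    also have "card ((\<lambda>x. (x, x)) ` C) = card C" by (intro card_image inj_onI) simp
    finally show ?thesis .
  qed
  (* Pairs on the diagonal differ in no place, so passing from P to T does not change the sum. *)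
  have wt_total: "(\<Sum>p\<in>P. real (wt p)) \<le> k * ((1 - 1 / real q) * card T)"
  proof -
    have col: "real (card {p \<in> T. fst p ! (m + j) \<noteq> snd p ! (m + j)})
        \<le> (1 - 1 / real q) * card T" if j: "j < k" for j
    proof -
      let ?E = "{(x, y) \<in> C \<times> C. take m x = take m y \<and> x ! (m + j) = y ! (m + j)}"
      have "card T \<le> card {0..<q} * card ?E"
        unfolding T_def
        by (rule coincidences_refine) (use finC ent j in \<open>auto simp: k_def\<close>)
      then have "card T \<le> q * card ?E" by simp
      then have "real (card T) \<le> real q * real (card ?E)"
        by (simp only: flip: of_nat_mult of_nat_le_iff)
      then have E: "real (card T) / q \<le> card ?E" using q by (simp add: field_simps)
      have sub: "?E \<subseteq> T" by (auto simp: T_def)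
      have "{p \<in> T. fst p ! (m + j) \<noteq> snd p ! (m + j)} = T - ?E" by (auto simp: T_def)
      then have "real (card {p \<in> T. fst p ! (m + j) \<noteq> snd p ! (m + j)}) = card T - real (card ?E)"
        using card_Diff_subset[OF finite_subset[OF sub finT] sub] card_mono[OF finT sub]
        by (simp add: of_nat_diff)
      with E show ?thesis by (simp add: algebra_simps)
    qed
    have "(\<Sum>p\<in>P. real (wt p)) \<le> (\<Sum>p\<in>T. real (wt p))"
      by (rule sum_mono2) (use finT PT in auto)
    also have "\<dots> = (\<Sum>p\<in>T. \<Sum>j<k. if fst p ! (m + j) \<noteq> snd p ! (m + j) then 1 else 0)"
      by (intro sum.cong refl, subst sum.inter_filter[symmetric]) (auto simp: wt_def)
    also have "\<dots> = (\<Sum>j<k. \<Sum>p\<in>T. if fst p ! (m + j) \<noteq> snd p ! (m + j) then 1 else 0)"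
      by (rule sum.swap)
    also have "\<dots> = (\<Sum>j<k. real (card {p \<in> T. fst p ! (m + j) \<noteq> snd p ! (m + j)}))"
      by (intro sum.cong refl, subst sum.inter_filter[symmetric]) (use finT in auto)
    also have "\<dots> \<le> (\<Sum>j<k. (1 - 1 / real q) * card T)"
      by (intro sum_mono col) simp
    finally show ?thesis by simp
  qed
  have wd: "prod_list (map w (d p)) = exp (- (ln 2 * wt p))" if pP: "p \<in> P" for p
  proof -
    obtain x y where p: "p = (x, y)" "x \<in> C" "y \<in> C" using pP by (auto simp: P_def)
    have "prod_list (map w (d p)) = (1 / 2) ^ card {j. j < length (d p) \<and> d p ! j \<noteq> 0}"
      unfolding w_def by (rule prod_list_half_weight)
    also have "{j. j < length (d p) \<and> d p ! j \<noteq> 0}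
        = {j. j < k \<and> fst p ! (m + j) \<noteq> snd p ! (m + j)}"
      using p m by (auto simp: d_def len k_def)
    also have "(1 / 2 :: real) ^ card \<dots> = exp (- (ln 2 * wt p))"
      by (simp add: wt_def exp_minus exp_of_nat2_mult power_one_over divide_simps)
    finally show ?thesis .
  qed
  have dL: "d ` P \<subseteq> L"
  proof safe
    fix x y assume "(x, y) \<in> P"
    then have xy: "x \<in> C" "y \<in> C" by (auto simp: P_def)
    have "d (x, y) ! j \<in> {- (int q - 1)..int q - 1}" if j: "j < k" for j
    proof -
      have "x ! (m + j) < q" "y ! (m + j) < q" using ent xy j by (simp_all add: k_def)
      then have "int (x ! (m + j)) - int (y ! (m + j)) \<in> {- (int q - 1)..int q - 1}"
        by simp
      moreover have "d (x, y) ! j = int (x ! (m + j)) - int (y ! (m + j))"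
        using j m xy by (simp add: d_def k_def len)
      ultimately show ?thesis by simp
    qed
    moreover have "length (d (x, y)) = k" using xy by (simp add: d_def k_def len)
    ultimately show "d (x, y) \<in> L" by (auto simp: L_def in_set_conv_nth)
  qed
  have finL: "finite L" unfolding L_def by (rule finite_lists_length_eq) simp
  have wpos: "prod_list (map w xs) \<ge> 0" for xs by (induction xs) (auto simp: w_def)
  have inj: "inj_on d P"
    unfolding d_def P_def by (rule B2_code_inj_on_suffix_difference[OF B2])
  (* Jensen on P against the total weight of all difference vectors, which is q ^ k. *)
  let ?a = "(\<Sum>p\<in>P. - (ln 2 * real (wt p))) / card P"
  have "real (card P) * exp ?a \<le> (\<Sum>p\<in>P. exp (- (ln 2 * wt p)))"
    by (rule card_le_exp_mean[OF finP ne])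
  also have "\<dots> = (\<Sum>v\<in>d ` P. prod_list (map w v))"
    using inj by (simp add: sum.reindex wd)
  also have "\<dots> \<le> (\<Sum>v\<in>L. prod_list (map w v))"
    by (rule sum_mono2[OF finL dL]) (rule wpos)
  also have "\<dots> = real q ^ k"
    unfolding L_def sum_prod_list_eq_power[OF finite_atLeastAtMost_int] w_def sum_half_weight[OF q] ..
  finally have "real (card P) * exp ?a \<le> real q ^ k" .
  then have "ln (real (card P) * exp ?a) \<le> ln (real q ^ k)"
    using cP q by (subst ln_le_cancel_iff) auto
  then have "ln (real (card P)) + ?a \<le> k * ln q"
    using cP q by (simp add: ln_mult ln_realpow)
  moreover have "- ?a \<le> ln 2 * (k * ((1 - 1 / real q) * card T)) / card P"
    using mult_left_mono[OF wt_total, of "ln 2"] cP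
    by (simp add: sum_negf sum_distrib_left divide_right_mono)
  ultimately have "ln (real (card P)) \<le>
      k * ln q + ln 2 * (k * ((1 - 1 / real q) * card T)) / card P"
    by linarith
  also have "\<dots> = k * (ln q + (1 - 1 / real q) * ln 2 *
      ((real (card P) + real (card C)) / real (card P)))"
    by (simp add: cT algebra_simps add_divide_distrib diff_divide_distrib)
  finally show ?thesis by (simp add: k_def)
qed

section \<open>The bound on the rate\<close>

lemma qary_code_card_le:
  assumes "qary_code q n C"
  shows "card C \<le> q ^ n"
proof -
  have "card C \<le> card {xs. set xs \<subseteq> {0..<q} \<and> length xs = n}"
    by (rule card_mono) (use assms in \<open>auto simp: qary_code_def finite_lists_length_eq\<close>)
  then show ?thesis by (simp add: card_lists_length_eq)
qed

text \<open>
  The prefix length is chosen with \<open>q\<^sup>m \<le> M / n < q\<^bsup>m + 1\<^esup>\<close>. Then the pairs with a common prefix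
  number at least \<open>n M\<close>, so the \<open>M\<close> diagonal pairs cost only a factor \<open>n / (n - 1)\<close> in \<open>h\<close>,
  and \<open>m\<close> falls short of \<open>log\<^sub>q M\<close> by at most \<open>log\<^sub>q n + 1\<close>.
\<close>
lemma B2_code_rate_le:
  assumes B2: "B2_code q n C" and q: "q \<ge> 2" and n: "n \<ge> 2" and C: "C \<noteq> {}"
    and h_def: "h = 1 + (1 - 1 / real q) * log q 2 * (real n / (real n - 1))"
  shows "log q (card C) / n \<le> h * (1 + (log q n + 1) / n) / (1 + h)"
proof -
  define M where "M = real (card C)"
  have qc: "qary_code q n C" using B2 by (simp add: B2_code_def)
  have finC: "finite C" by (rule qary_code_finite[OF qc])
  have M1: "M \<ge> 1" using finC C by (simp add: M_def Suc_le_eq card_gt_0_iff)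
  have h1: "h \<ge> 1" unfolding h_def using q n by (simp add: field_simps)
  have logn: "log q n \<ge> 0" using q n by simp
  have Mq: "M \<le> real q ^ n" using qary_code_card_le[OF qc] unfolding M_def
    by (metis of_nat_le_iff of_nat_power)
  then have logMn: "log q M \<le> n"
    using q M1 by (simp add: log_le_iff powr_realpow)
  have key: "log q M * (1 + h) \<le> h * (n + log q n + 1)"
  proof (cases "M < n")
    (* There is no room for a prefix here, but the rate is below the error term. *)
    case True
    then have "log q M \<le> log q n" using q M1 by simp
    then have "log q M * h \<le> log q n * h" using h1 by (intro mult_right_mono) auto
    moreover have "log q M \<le> h * n" using logMn mult_right_mono[OF h1, of "real n"] by simp
    ultimately show ?thesis using h1 unfolding distrib_left mult.commute[of _ h] by linarith
  next
    case False
    define m where "m = nat \<lfloor>log q (M / n)\<rfloor>"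
    have Mn: "M / n \<ge> 1" using False n by simp
    then have "log q (M / n) \<ge> 0" using q by simp
    then have m: "real m \<le> log q (M / n)" "log q (M / n) < real m + 1"
      unfolding m_def by linarith+
    have lg: "log q (M / n) = log q M - log q n" using M1 n q by (simp add: log_divide)
    have mn: "m \<le> n" using m(1) lg logMn logn by linarith
    have qm: "real q ^ m \<le> M / n"
      using m(1) q Mn by (simp add: le_log_iff powr_realpow)
    define P where "P = {(x, y) \<in> C \<times> C. take m x = take m y \<and> x \<noteq> y}"
    define T where "T = {(x, y) \<in> C \<times> C. take m x = take m y}"
    let ?A = "{xs. set xs \<subseteq> {0..<q} \<and> length xs = m}"
    have "card {(x, y) \<in> C \<times> C. () = ()} \<le> card ?A *
        card {(x, y) \<in> C \<times> C. () = () \<and> take m x = take m y}"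
    proof (rule coincidences_refine[OF finC])
      show "finite ?A" by (rule finite_lists_length_eq) simp
      show "take m ` C \<subseteq> ?A"
        using qc mn by (auto simp: qary_code_def dest!: in_set_takeD)
    qed
    moreover have "{(x, y) \<in> C \<times> C. () = ()} = C \<times> C" by auto
    ultimately have "card (C \<times> C) \<le> q ^ m * card T"
      by (simp add: card_lists_length_eq T_def)
    then have "M * M \<le> real q ^ m * card T"
      unfolding M_def card_cartesian_product by (metis of_nat_le_iff of_nat_mult of_nat_power)
    also have "\<dots> \<le> M / n * card T" by (rule mult_right_mono[OF qm]) simp
    finally have "n * M \<le> card T" using M1 n by (simp add: field_simps)
    moreover have "card T \<le> card P + card C"
    proof -
      have "T \<subseteq> P \<union> (\<lambda>x. (x, x)) ` C" by (auto simp: T_def P_def)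
      moreover have "finite P"
        using finC by (auto simp: P_def intro: finite_subset[of _ "C \<times> C"])
      ultimately have "card T \<le> card (P \<union> (\<lambda>x. (x, x)) ` C)"
        using finC by (intro card_mono) auto
      also have "\<dots> \<le> card P + card ((\<lambda>x. (x, x)) ` C)" by (rule card_Un_le)
      also have "\<dots> \<le> card P + card C" using card_image_le[OF finC] by simp
      finally show ?thesis .
    qed
    ultimately have P: "(real n - 1) * M \<le> card P" unfolding M_def by (simp add: algebra_simps)
    have MP: "M \<le> card P"
    proof -
      have "1 * M \<le> (real n - 1) * M" using n M1 by (intro mult_right_mono) auto
      with P show ?thesis by simp
    qed
    then have Pne: "P \<noteq> {}" using M1 by auto
    have ratio: "(real (card P) + M) / card P \<le> n / (real n - 1)"
      using P n M1 MP by (simp add: field_simps)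
    (* P has at least (n - 1) M elements, but a factor n - 1 does not affect the rate. *)
    have "log q M \<le> log q (card P)" using MP M1 q by simp
    also have "\<dots> = ln (card P) / ln q" by (simp add: log_def)
    also have "\<dots> \<le> (real (n - m) * (ln q + (1 - 1 / real q) * ln 2 *
        ((real (card P) + real (card C)) / real (card P)))) / ln q"
      by (intro divide_right_mono B2_code_card_pairs_le[OF B2 _ mn P_def Pne]) (use q in auto)
    also have "\<dots> = real (n - m) * (1 + (1 - 1 / real q) * log q 2 *
        ((real (card P) + M) / real (card P)))"
      using q by (simp add: M_def log_def distrib_left add_divide_distrib)
    also have "\<dots> \<le> real (n - m) * h"
      unfolding h_def using q by (intro mult_left_mono add_left_mono ratio) auto
    also have "\<dots> \<le> (n - (log q M - log q n - 1)) * h"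
      using m(2) lg mn h1 by (intro mult_right_mono) (auto simp: of_nat_diff)
    finally show ?thesis by (simp add: algebra_simps)
  qed
  have "log q M / n * (1 + h) = log q M * (1 + h) / n" by simp
  also have "\<dots> \<le> h * (n + log q n + 1) / n" using key by (rule divide_right_mono) simp
  also have "\<dots> = h * (1 + (log q n + 1) / n)"
    using n by (simp add: distrib_left add_divide_distrib)
  finally show ?thesis using h1 by (simp only: M_def pos_le_divide_eq)
qed

theorem theorem3p2:
  fixes q :: nat and C :: "nat \<Rightarrow> nat list set"
  assumes "q \<ge> 2"
    and "\<And>n. n \<ge> 1 \<Longrightarrow> B2_code q n (C n)"
  shows "limsup (\<lambda>n. ereal (1 / real n) * elog q (card (C n)))
    \<le> ereal ((real q + (real q - 1) * log (real q) 2) / (2 * real q + (real q - 1) * log (real q) 2))"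
proof -
  define h where "h n = 1 + (1 - 1 / real q) * log q 2 * (real n / (real n - 1))" for n :: nat
  define b where "b n = h n * (1 + (log q n + 1) / n) / (1 + h n)" for n :: nat
  define H where "H = 1 + (1 - 1 / real q) * log q 2"
  have H: "H \<ge> 1" unfolding H_def using assms(1) by simp
  have "(\<lambda>n. real n / (real n - 1)) \<longlonglongrightarrow> 1" by real_asymp
  then have "h \<longlonglongrightarrow> 1 + (1 - 1 / real q) * log q 2 * 1"
    unfolding h_def by (intro tendsto_intros)
  then have h: "h \<longlonglongrightarrow> H" by (simp add: H_def)
  have lnn: "(\<lambda>n. ln (real n) / real n) \<longlonglongrightarrow> 0" "(\<lambda>n. 1 / real n) \<longlonglongrightarrow> 0" by real_asymp+
  have "(\<lambda>n. 1 / ln q * (ln (real n) / real n) + 1 / real n) \<longlonglongrightarrow> 1 / ln q * 0 + 0"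
    by (intro tendsto_intros lnn)
  then have e: "(\<lambda>n. (log q n + 1) / n) \<longlonglongrightarrow> 0"
    by (simp add: log_def add_divide_distrib)
  have "b \<longlonglongrightarrow> H * (1 + 0) / (1 + H)"
    unfolding b_def by (intro tendsto_intros h e) (use H in auto)
  also have "H * (1 + 0) / (1 + H) = (real q + (real q - 1) * log q 2) / (2 * real q + (real q - 1) * log q 2)"
  proof -
    have num: "real q + (real q - 1) * log q 2 = q * H"
      using assms(1) by (simp add: H_def field_simps)
    then have "2 * real q + (real q - 1) * log q 2 = q * (1 + H)" by (simp add: algebra_simps)
    with num show ?thesis using assms(1) by simp
  qed
  finally have b: "(\<lambda>n. ereal (b n)) \<longlonglongrightarrow>
      ereal ((real q + (real q - 1) * log q 2) / (2 * real q + (real q - 1) * log q 2))"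
    by simp
  have "ereal (1 / real n) * elog q (card (C n)) \<le> ereal (b n)" if n: "n \<ge> 2" for n
  proof (cases "card (C n) = 0")
    case True
    with n show ?thesis by (simp add: elog_def)
  next
    case False
    then have "C n \<noteq> {}" by auto
    then have "log q (card (C n)) / n \<le> b n"
      unfolding b_def by (intro B2_code_rate_le assms h_def) (use n assms in auto)
    with False show ?thesis by (simp add: elog_def)
  qed
  then have "limsup (\<lambda>n. ereal (1 / real n) * elog q (card (C n))) \<le> limsup (\<lambda>n. ereal (b n))"
    by (intro Limsup_mono eventually_sequentiallyI[of 2])
  also have "\<dots> = ereal ((real q + (real q - 1) * log q 2) / (2 * real q + (real q - 1) * log q 2))"
    by (rule lim_imp_Limsup[OF trivial_limit_sequentially b])
  finally show ?thesis .
qed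

end
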